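(* The game $\Gamma:=(\mathcal I,\{J_i\}_{i\in\mathcal I},\{\mathcal X_i\}_{i\in\mathcal I})$ with $$J_i(x_i,\boldsymbol x_{-i})=\frac12\Big(\dot q_i^\top\dot q_i+\sum_{\ell\in\mathcal L_i}k_\ell\,(\|q_i-q_k\|-r_\ell)^2\Big)$$ (where in the $\ell$-th summand $k$ in $q_k$ denotes the other endpoint of edge $\ell$) is an exact potential game with potential function $$H(\boldsymbol x)=\frac12\sum_{i\in\mathcal I}\dot q_i^\top\dot q_i+\frac12\sum_{j\in E}k_j(\|z_j\|-r_j)^2,\qquad z=\bar B q .$$
   Context: Notation: $(x_1;\ldots;x_N)$ denotes the stacked column vector, $\|\cdot\|$ is the Euclidean norm, and $\otimes$ is the Kronecker product. Agents and graph: there are $N$ agents, indexed by $\mathcal I=\{1,\ldots,N\}$, with positions $q_i\in\mathbb R^n$ and velocities $\dot q_i\in\mathbb R^n$; $q=(q_1;\ldots;q_N)$. $\mathcal G=(V,E)$ is a graph with $V=\mathcal I$ and $|E|=M$ arbitrarily oriented edges. $B=(b_{i,j})\in\mathbb R^{N\times M}$ is the incidence matrix ($b_{i,j}=-1$ if $i$ is the tail of edge $j$, $+1$ if it is the head, $0$ otherwise). Put $\bar B:=B^\top\otimes I_n$ and $z=\bar Bq$, so $z_j=q_k-q_i$ if edge $j$ goes from $i$ to $k$. To each edge $j\in E$ are associated a constant elastic coefficient $k_j>0$ and a rest length $r_j$ with $0\le r_j\le r^{\mathrm c}$, where $r^{\mathrm c}>0$ is a critical distance. Strategies: player $i\in\mathcal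 I$ has decision variable $x_i=(q_i;\dot q_i)\in\mathcal X_i\subset\mathbb R^{2n}$, with $\mathcal X_i$ compact and convex. The collective strategy $\boldsymbol x=(q;\dot q)$ lies in $\boldsymbol{\mathcal X}=\prod_{i\in\mathcal I}\mathcal X_i\subset\mathbb R^{2nN}$ (up to ordering of coordinates), and $\boldsymbol x_{-i}$ collects the strategies of all players except $i$; write $\boldsymbol x=(x_i,\boldsymbol x_{-i})$. $\mathcal L_i:=\{j\in E\;|\;b_{i,j}\ne0\}$ is the set of edges involving $i$. Definition: the game is an exact potential game with potential function $P:\boldsymbol{\mathcal X}\to\mathbb R$ if for all $i\in\mathcal I$, all $\boldsymbol x_{-i}$, and all $x_i,y_i\in\mathcal X_i$: $J_i(x_i,\boldsymbol x_{-i})-J_i(y_i,\boldsymbol x_{-i})=P(x_i,\boldsymbol x_{-i})-P(y_i,\boldsymbol x_{-i})$. *)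

theory Defs
  imports "HOL-Analysis.Analysis" "Graph_Theory.Digraph"
begin

text \<open>
  Real matrices are functions of a row and a column index, and the index sets are supplied where
  sums are formed. Unlike \<open>real ^ 'm ^ 'n\<close>, this allows an empty index set, as needed for the
  incidence matrix of a graph without edges. Rows and columns of a Kronecker product are indexed
  by pairs, and a stacked vector is indexed by (block, coordinate within the block).
\<close>

definition mat_transpose :: "('r \<Rightarrow> 'c \<Rightarrow> real) \<Rightarrow> 'c \<Rightarrow> 'r \<Rightarrow> real" where
  "mat_transpose A = (\<lambda>j i. A i j)"

definition mat_identity :: "'d \<Rightarrow> 'd \<Rightarrow> real" where
  "mat_identity = (\<lambda>a b. if a = b then 1 else 0)"

definition kronecker ::
    "('r \<Rightarrow> 'c \<Rightarrow> real) \<Rightarrow> ('s \<Rightarrow> 'd \<Rightarrow> real) \<Rightarrow> 'r \<times> 's \<Rightarrow> 'c \<times> 'd \<Rightarrow> real" where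
  "kronecker A C = (\<lambda>(i, a) (j, b). A i j * C a b)"

definition mat_mult_vec :: "'c set \<Rightarrow> ('r \<Rightarrow> 'c \<Rightarrow> real) \<Rightarrow> ('c \<Rightarrow> real) \<Rightarrow> 'r \<Rightarrow> real" where
  "mat_mult_vec C A v = (\<lambda>i. \<Sum>j\<in>C. A i j * v j)"

definition stacked :: "('i \<Rightarrow> real ^ 'd) \<Rightarrow> 'i \<times> 'd \<Rightarrow> real" where
  "stacked q = (\<lambda>(i, a). q i $ a)"

definition block :: "('e \<times> 'd \<Rightarrow> real) \<Rightarrow> 'e \<Rightarrow> real ^ 'd" where
  "block v j = (\<chi> a. v (j, a))"

text \<open>
  A graph with arbitrarily oriented edges is a digraph whose arcs are the edges, each listed once,
  and \<open>tail\<close> and \<open>head\<close> give the chosen orientation.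
\<close>

definition incidence :: "('i, 'e) pre_digraph \<Rightarrow> 'i \<Rightarrow> 'e \<Rightarrow> real" where
  "incidence G i j = (if i = tail G j then - 1 else if i = head G j then 1 else 0)"

definition B_bar :: "('i, 'e) pre_digraph \<Rightarrow> 'e \<times> 'd \<Rightarrow> 'i \<times> 'd \<Rightarrow> real" where
  "B_bar G = kronecker (mat_transpose (incidence G)) mat_identity"

definition edge_vec :: "('i, 'e) pre_digraph \<Rightarrow> ('i \<Rightarrow> real ^ 'd) \<Rightarrow> 'e \<Rightarrow> real ^ 'd" where
  "edge_vec G q = block (mat_mult_vec (verts G \<times> UNIV) (B_bar G) (stacked q))"

definition edges_at :: "('i, 'e) pre_digraph \<Rightarrow> 'i \<Rightarrow> 'e set" where
  "edges_at G i = {j \<in> arcs G. incidence G i j \<noteq> 0}"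

definition other_end :: "('i, 'e) pre_digraph \<Rightarrow> 'i \<Rightarrow> 'e \<Rightarrow> 'i" where
  "other_end G i j = (if tail G j = i then head G j else tail G j)"

text \<open>
  A strategy profile \<open>x\<close> assigns to agent \<open>i\<close> the pair \<open>x i\<close> of its position and its velocity.
\<close>

definition agent_cost ::
    "('i, 'e) pre_digraph \<Rightarrow> ('e \<Rightarrow> real) \<Rightarrow> ('e \<Rightarrow> real) \<Rightarrow>
     'i \<Rightarrow> ('i \<Rightarrow> (real ^ 'd) \<times> (real ^ 'd)) \<Rightarrow> real" where
  "agent_cost G k r i x =
     1 / 2 * (snd (x i) \<bullet> snd (x i)
       + (\<Sum>l\<in>edges_at G i. k l * (norm (fst (x i) - fst (x (other_end G i l))) - r l)\<^sup>2))"

definition total_energy ::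
    "('i, 'e) pre_digraph \<Rightarrow> ('e \<Rightarrow> real) \<Rightarrow> ('e \<Rightarrow> real) \<Rightarrow>
     ('i \<Rightarrow> (real ^ 'd) \<times> (real ^ 'd)) \<Rightarrow> real" where
  "total_energy G k r x =
     1 / 2 * (\<Sum>i\<in>verts G. snd (x i) \<bullet> snd (x i))
     + 1 / 2 * (\<Sum>j\<in>arcs G. k j * (norm (edge_vec G (\<lambda>i. fst (x i)) j) - r j)\<^sup>2)"

text \<open>
  The profile \<open>(x\<^sub>i, x\<^sub>-\<^sub>i)\<close> is the update of \<open>x\<^sub>-\<^sub>i\<close> at \<open>i\<close>.
\<close>

definition exact_potential_game ::
    "'i set \<Rightarrow> ('i \<Rightarrow> ('i \<Rightarrow> 's) \<Rightarrow> real) \<Rightarrow> ('i \<Rightarrow> 's set) \<Rightarrow> (('i \<Rightarrow> 's) \<Rightarrow> real) \<Rightarrow> bool" where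
  "exact_potential_game I J X P \<longleftrightarrow>
     (\<forall>i\<in>I. \<forall>x'\<in>(\<Pi>\<^sub>E j\<in>I - {i}. X j). \<forall>xi\<in>X i. \<forall>yi\<in>X i.
        J i (x'(i := xi)) - J i (x'(i := yi)) = P (x'(i := xi)) - P (x'(i := yi)))"

end

theory Submission
  imports Defs
begin

text \<open>
  The energy is the cost of agent \<open>i\<close> plus the kinetic energy of the other agents and the elastic
  energy of the edges avoiding \<open>i\<close>, and the last two do not depend on the strategy of \<open>i\<close>.
\<close>

text \<open>Row \<open>(j, a)\<close> of \<open>B_bar G\<close> has just two nonzero entries: the
  identity factor of the Kronecker product confines it to coordinate \<open>a\<close>, and column
  \<open>j\<close> of the incidence matrix vanishes away from the two ends of
  \<open>j\<close>.\<close>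

lemma edge_vec_eq:
  fixes q :: "'i \<Rightarrow> real ^ 'd"
  assumes "fin_digraph G" and "loopfree_digraph G" and j: "j \<in> arcs G"
  shows "edge_vec G q j = q (head G j) - q (tail G j)"
proof (rule vec_eq_iff[THEN iffD2], rule allI)
  fix a :: 'd
  interpret fin_digraph G by fact
  interpret loopfree_digraph G by fact
  have ends: "tail G j \<in> verts G" "head G j \<in> verts G" "tail G j \<noteq> head G j"
    using j no_loops by auto
  have "edge_vec G q j $ a =
      (\<Sum>(i, b)\<in>verts G \<times> UNIV. incidence G i j * (if a = b then 1 else 0) * q i $ b)"
    by (simp add: edge_vec_def block_def mat_mult_vec_def B_bar_def kronecker_def
        mat_transpose_def mat_identity_def stacked_def case_prod_unfold)
  also have "\<dots> = (\<Sum>i\<in>verts G. \<Sum>b\<in>UNIV. if a = b then incidence G i j * q i $ b else 0)"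
    by (subst sum.cartesian_product[symmetric]) (intro sum.cong refl, simp)
  also have "\<dots> = (\<Sum>i\<in>verts G. incidence G i j * q i $ a)"
    by simp
  \<comment> \<open>The incidence entry becomes a difference of two indicators. This rests on
    \<open>tail G j \<noteq> head G j\<close>: at a loop the indicators would cancel, while
    \<open>incidence\<close> would give -1.\<close>
  also have "\<dots> = (\<Sum>i\<in>verts G. (if i = head G j then q i $ a else 0)
      - (if i = tail G j then q i $ a else 0))"
    using ends by (intro sum.cong refl) (auto simp: incidence_def)
  also have "\<dots> = (q (head G j) - q (tail G j)) $ a"
    using ends by (simp add: sum_subtractf)
  finally show "edge_vec G q j $ a = (q (head G j) - q (tail G j)) $ a" .
qed

text \<open>The orientation of an edge affects only the sign of its vector, which the norm ignores,
  so both ends see the same elastic term.\<close>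

lemma norm_edge_vec_at:
  fixes q :: "'i \<Rightarrow> real ^ 'd"
  assumes "fin_digraph G" and "loopfree_digraph G" and j: "j \<in> edges_at G i"
  shows "norm (edge_vec G q j) = norm (q i - q (other_end G i j))"
proof -
  have "j \<in> arcs G" "i = tail G j \<or> i = head G j"
    using j by (auto simp: edges_at_def incidence_def split: if_splits)
  then show ?thesis
    using assms(1,2) by (auto simp: edge_vec_eq other_end_def norm_minus_commute)
qed

definition energy_without ::
    "('i, 'e) pre_digraph \<Rightarrow> ('e \<Rightarrow> real) \<Rightarrow> ('e \<Rightarrow> real) \<Rightarrow>
     'i \<Rightarrow> ('i \<Rightarrow> (real ^ 'd) \<times> (real ^ 'd)) \<Rightarrow> real" where
  "energy_without G k r i x =
     1 / 2 * (\<Sum>m\<in>verts G - {i}. snd (x m) \<bullet> snd (x m))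
     + 1 / 2 * (\<Sum>j\<in>arcs G - edges_at G i. k j * (norm (edge_vec G (\<lambda>m. fst (x m)) j) - r j)\<^sup>2)"

text \<open>The energy is not the sum of the costs: an edge enters the costs of both its ends but
  counts once in the energy, with the same factor 1/2. Hence the cost of \<open>i\<close> splits off
  whole.\<close>

lemma total_energy_split:
  fixes x :: "'i \<Rightarrow> (real ^ 'd) \<times> (real ^ 'd)"
  assumes "fin_digraph G" and "loopfree_digraph G" and i: "i \<in> verts G"
  shows "total_energy G k r x = agent_cost G k r i x + energy_without G k r i x"
proof -
  interpret fin_digraph G by fact
  let ?e = "\<lambda>j. k j * (norm (edge_vec G (\<lambda>m. fst (x m)) j) - r j)\<^sup>2"
  have "sum ?e (arcs G) = sum ?e (arcs G - edges_at G i) + sum ?e (edges_at G i)"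
    by (rule sum.subset_diff) (auto simp: edges_at_def)
  moreover have "sum ?e (edges_at G i) =
      (\<Sum>l\<in>edges_at G i. k l * (norm (fst (x i) - fst (x (other_end G i l))) - r l)\<^sup>2)"
    using assms(1,2) by (intro sum.cong refl) (simp add: norm_edge_vec_at)
  moreover have "(\<Sum>m\<in>verts G. snd (x m) \<bullet> snd (x m)) =
      snd (x i) \<bullet> snd (x i) + (\<Sum>m\<in>verts G - {i}. snd (x m) \<bullet> snd (x m))"
    using i by (intro sum.remove) auto
  ultimately show ?thesis
    unfolding total_energy_def agent_cost_def energy_without_def by (simp add: algebra_simps)
qed

lemma energy_without_upd:
  fixes x :: "'i \<Rightarrow> (real ^ 'd) \<times> (real ^ 'd)"
  assumes "fin_digraph G" and "loopfree_digraph G"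
  shows "energy_without G k r i (x(i := s)) = energy_without G k r i x"
proof -
  have "edge_vec G (\<lambda>m. fst ((x(i := s)) m)) j = edge_vec G (\<lambda>m. fst (x m)) j"
    if "j \<in> arcs G - edges_at G i" for j
  proof -
    \<comment> \<open>A zero incidence entry at \<open>i\<close> excludes \<open>i\<close> from both
      ends, and the edge vector reads positions only there.\<close>
    have "j \<in> arcs G" "tail G j \<noteq> i" "head G j \<noteq> i"
      using that by (auto simp: edges_at_def incidence_def split: if_splits)
    then show ?thesis
      using assms by (simp add: edge_vec_eq)
  qed
  then show ?thesis
    unfolding energy_without_def by (intro arg_cong2[where f = "(+)"] arg_cong2[where f = "(*)"] sum.cong refl) auto
qed

theorem proposition2:
  fixes N M :: nat
    and G :: "(nat, 'e) pre_digraph"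
    and k r :: "'e \<Rightarrow> real"
    and rc :: real
    and X :: "nat \<Rightarrow> ((real ^ 'd) \<times> (real ^ 'd)) set"
  assumes "fin_digraph G" and "loopfree_digraph G"
    and "verts G = {1..N}" and "card (arcs G) = M"
    and "rc > 0"
    and "\<And>j. j \<in> arcs G \<Longrightarrow> k j > 0"
    and "\<And>j. j \<in> arcs G \<Longrightarrow> 0 \<le> r j \<and> r j \<le> rc"
    and "\<And>i. i \<in> {1..N} \<Longrightarrow> compact (X i)"
    and "\<And>i. i \<in> {1..N} \<Longrightarrow> convex (X i)"
  shows "exact_potential_game {1..N} (agent_cost G k r) X (total_energy G k r)"
proof -
  \<comment> \<open>Both remainders equal \<open>energy_without G k r i x\<close> and cancel. Here
    \<open>x\<close> is an arbitrary function, which covers the profiles of the other agents, whose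
    value at \<open>i\<close> is \<open>undefined\<close> until the update.\<close>
  have "agent_cost G k r i (x(i := s)) - agent_cost G k r i (x(i := t)) =
      total_energy G k r (x(i := s)) - total_energy G k r (x(i := t))"
    if "i \<in> {1..N}" for i x s t
    using that assms(1-3) by (simp add: total_energy_split[of G i] energy_without_upd)
  then show ?thesis
    unfolding exact_potential_game_def by blast
qed

end
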